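(* Let $t$ and $e$ be integers such that $2\le t\le e-1$. Then there exists an almost symmetric numerical semigroup $S$ with maximal reduced type such that $\mathrm{t}(S)=t$ and $\mathrm{e}(S)=e$.
   Context: $\mathbb{N}=\{z\in\mathbb{Z}\mid z\ge 0\}$. A numerical semigroup is a submonoid $S$ of $(\mathbb{N},+)$ (containing $0$) with $\mathbb{N}\setminus S$ finite. The multiplicity $\mathrm{m}(S)$ is the smallest element of $S\setminus\{0\}$; the Frobenius number $\mathrm{F}(S)$ is the largest element of $\mathbb{Z}\setminus S$; the genus $\mathrm{g}(S)$ is the cardinality of $\mathbb{N}\setminus S$. Every numerical semigroup has a unique minimal system of generators $\mathrm{msg}(S)$; its cardinality $\mathrm{e}(S)$ is the embedding dimension. The set of pseudo-Frobenius numbers is $\mathrm{PF}(S)=\{x\in\mathbb{Z}\setminus S\mid x+s\in S\text{ for all }0\ne s\in S\}$, and the type $\mathrm{t}(S)$ is its cardinality. $S$ is almost symmetric if $\mathrm{g}(S)=\frac{\mathrm{F}(S)+\mathrm{t}(S)}{2}$. Put $\mathrm{rPF}(S)=\{x\in\mathbb{Z}\setminus S\mid \mathrm{F}(S)-\mathrm{m}(S)+1\le x\le \mathrm{F}(S)\}$ and let $s(S)$ be its cardinality (the reduced type); $S$ has maximal reduced type if $s(S)=\mathrm{t}(S)$. *)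

theory Defs
  imports Complex_Main
begin

text \<open>Numerical semigroups are sets of integers, so that the complement \<open>- S\<close> is taken in the
  integers, as in the definitions of the Frobenius and pseudo-Frobenius numbers.\<close>

definition nat_submonoid :: "int set \<Rightarrow> bool" where
  "nat_submonoid S \<longleftrightarrow> S \<subseteq> {0..} \<and> 0 \<in> S \<and> (\<forall>x\<in>S. \<forall>y\<in>S. x + y \<in> S)"

definition numerical_semigroup :: "int set \<Rightarrow> bool" where
  "numerical_semigroup S \<longleftrightarrow> nat_submonoid S \<and> finite ({0..} - S)"

definition multiplicity :: "int set \<Rightarrow> int" where
  "multiplicity S = (LEAST x. x \<in> S - {0})"

text \<open>\<open>- S\<close> is infinite (it contains all negative integers), hence \<open>GREATEST\<close> and not \<open>Max\<close>.\<close>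

definition frobenius :: "int set \<Rightarrow> int" where
  "frobenius S = (GREATEST x. x \<in> - S)"

definition genus :: "int set \<Rightarrow> nat" where
  "genus S = card ({0..} - S)"

definition minimal_generators :: "int set \<Rightarrow> int set \<Rightarrow> bool" where
  "minimal_generators S A \<longleftrightarrow> nat_submonoid hull A = S \<and> (\<forall>B. B \<subset> A \<longrightarrow> nat_submonoid hull B \<noteq> S)"

definition msg :: "int set \<Rightarrow> int set" where
  "msg S = (THE A. minimal_generators S A)"

definition embedding_dim :: "int set \<Rightarrow> nat" where
  "embedding_dim S = card (msg S)"

definition PF :: "int set \<Rightarrow> int set" where
  "PF S = {x \<in> - S. \<forall>s\<in>S. s \<noteq> 0 \<longrightarrow> x + s \<in> S}"

definition sg_type :: "int set \<Rightarrow> nat" where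
  "sg_type S = card (PF S)"

definition almost_symmetric :: "int set \<Rightarrow> bool" where
  "almost_symmetric S \<longleftrightarrow> real (genus S) = (real_of_int (frobenius S) + real (sg_type S)) / 2"

definition rPF :: "int set \<Rightarrow> int set" where
  "rPF S = {x \<in> - S. frobenius S - multiplicity S + 1 \<le> x \<and> x \<le> frobenius S}"

definition reduced_type :: "int set \<Rightarrow> nat" where
  "reduced_type S = card (rPF S)"

definition maximal_reduced_type :: "int set \<Rightarrow> bool" where
  "maximal_reduced_type S \<longleftrightarrow> reduced_type S = sg_type S"

text \<open>The description in \<open>msg\<close> is proper: the minimal system of generators exists and is unique.\<close>

lemma nat_submonoid_hull:
  assumes "A \<subseteq> {0..}"
  shows "nat_submonoid (nat_submonoid hull A)"
proof -
  have "nat_submonoid {0..}" by (auto simp: nat_submonoid_def)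
  with assms show ?thesis
    unfolding hull_def nat_submonoid_def by blast
qed

lemma minimal_generators_iff:
  assumes S: "nat_submonoid S"
  shows "minimal_generators S A \<longleftrightarrow> A = {x \<in> S - {0}. \<forall>y\<in>S - {0}. \<forall>z\<in>S - {0}. x \<noteq> y + z}"
    (is "_ \<longleftrightarrow> A = ?M")
proof -
  have pos: "x > 0" if "x \<in> S - {0}" for x
    using S that by (force simp: nat_submonoid_def)
  have sub: "?M \<subseteq> B" if B: "nat_submonoid hull B = S" for B
  proof (rule ccontr)
    assume "\<not> ?M \<subseteq> B"
    then obtain a where a: "a \<in> ?M" "a \<notin> B" by blast
    have "nat_submonoid (S - {a})"
      unfolding nat_submonoid_def
    proof (intro conjI ballI)
      fix x y assume xy: "x \<in> S - {a}" "y \<in> S - {a}"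
      have "x + y \<noteq> a"
        using a xy by (cases "x = 0"; cases "y = 0") auto
      then show "x + y \<in> S - {a}" using xy S by (auto simp: nat_submonoid_def)
    qed (use S a in \<open>auto simp: nat_submonoid_def\<close>)
    moreover have "B \<subseteq> S - {a}" using B hull_subset[of B nat_submonoid] a by blast
    ultimately have "nat_submonoid hull B \<subseteq> S - {a}" by (intro hull_minimal)
    with B a show False by blast
  qed
  have "?M \<subseteq> {0..}" using pos by force
  then have H: "nat_submonoid (nat_submonoid hull ?M)" by (rule nat_submonoid_hull)
  have in_hull: "x \<in> nat_submonoid hull ?M" if "x \<in> S" for x
    using that
  proof (induction "nat x" arbitrary: x rule: less_induct)
    case less
    show ?case
    proof (cases "x = 0 \<or> x \<in> ?M")
      case True
      then show ?thesis using H hull_subset[of ?M nat_submonoid] by (auto simp: nat_submonoid_def)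
    next
      case False
      then obtain y z where yz: "y \<in> S - {0}" "z \<in> S - {0}" "x = y + z" using less.prems by blast
      then have "nat y < nat x" "nat z < nat x" using pos[of y] pos[of z] by auto
      then have "y \<in> nat_submonoid hull ?M" "z \<in> nat_submonoid hull ?M" using less.hyps yz by auto
      then show ?thesis using H yz(3) by (auto simp: nat_submonoid_def)
    qed
  qed
  have "nat_submonoid hull ?M \<subseteq> S" by (rule hull_minimal) (use S in auto)
  with in_hull have "nat_submonoid hull ?M = S" by blast
  with sub show ?thesis
    unfolding minimal_generators_def by (metis (no_types, lifting) psubsetI psubsetE)
qed

lemma minimal_generators_msg:
  assumes "numerical_semigroup S"
  shows "minimal_generators S (msg S)"
proof -
  have "nat_submonoid S" using assms by (simp add: numerical_semigroup_def)
  then have "\<exists>!A. minimal_generators S A" by (simp only: minimal_generators_iff) blast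
  then show ?thesis unfolding msg_def by (rule theI')
qed

end

theory Submission
  imports Defs
begin

text \<open>The witness is the half-line from the multiplicity \<open>m\<close> on, with one further gap \<open>F < 2 * m\<close>
  and with \<open>0\<close> added. Its gaps are \<open>1, \<dots>, m - 1\<close> and \<open>F\<close>, so its genus is \<open>m\<close>.

  A gap \<open>x\<close> with \<open>x \<le> F - m\<close> is not pseudo-Frobenius, because \<open>F - x\<close> lies in the semigroup and
  \<open>x + (F - x) = F\<close> does not. A gap \<open>x > F - m\<close> is pseudo-Frobenius, because adding \<open>m\<close> or more
  carries it past \<open>F\<close>. Hence the pseudo-Frobenius numbers are exactly the gaps among
  \<open>F - m + 1, \<dots>, F\<close>, which is maximality of the reduced type. There are \<open>2 * m - F\<close> of them, and
  \<open>2 * m = F + (2 * m - F)\<close> is almost symmetry.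

  Sums of two nonzero elements are at least \<open>2 * m\<close>, and once \<open>F \<ge> m + 2\<close> every integer from
  \<open>2 * m\<close> on is such a sum. The minimal generators are then the \<open>m - 1\<close> elements of
  \<open>m, \<dots>, 2 * m - 1\<close> other than \<open>F\<close>. Solving \<open>m - 1 = e\<close> and \<open>2 * m - F = t\<close> gives \<open>m = e + 1\<close>
  and \<open>F = 2 * (e + 1) - t\<close>; the conditions \<open>m + 2 \<le> F\<close> and \<open>F < 2 * m\<close> become \<open>t \<le> e - 1\<close> and
  \<open>0 < t\<close>.\<close>

definition punctured_ray :: "int \<Rightarrow> int \<Rightarrow> int set" where
  "punctured_ray m F = insert 0 ({m..} - {F})"

lemma gaps_punctured_ray:
  assumes "0 < m" "m \<le> F"
  shows "{0..} - punctured_ray m F = insert F {1..<m}"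
  using assms by (auto simp: punctured_ray_def)

lemma numerical_semigroup_punctured_ray:
  assumes "0 < m" "m \<le> F" "F < 2 * m"
  shows "numerical_semigroup (punctured_ray m F)"
proof -
  have "nat_submonoid (punctured_ray m F)"
    using assms by (auto simp: nat_submonoid_def punctured_ray_def)
  then show ?thesis
    using assms by (simp add: numerical_semigroup_def gaps_punctured_ray)
qed

lemma multiplicity_punctured_ray:
  assumes "0 < m" "m < F"
  shows "multiplicity (punctured_ray m F) = m"
  unfolding multiplicity_def
  by (rule Least_equality) (use assms in \<open>auto simp: punctured_ray_def\<close>)

lemma frobenius_punctured_ray:
  assumes "0 < m" "m \<le> F"
  shows "frobenius (punctured_ray m F) = F"
  unfolding frobenius_def
  by (rule Greatest_equality) (use assms in \<open>auto simp: punctured_ray_def\<close>)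

lemma genus_punctured_ray:
  assumes "0 < m" "m \<le> F"
  shows "int (genus (punctured_ray m F)) = m"
  using assms by (simp add: genus_def gaps_punctured_ray)

lemma PF_punctured_ray:
  assumes "0 < m" "m < F"
  shows "PF (punctured_ray m F) = insert F {F - m<..<m}"
proof (rule set_eqI, rule iffI)
  fix x assume x: "x \<in> PF (punctured_ray m F)"
  then have gap: "x \<notin> punctured_ray m F"
    and shift: "\<And>s. s \<in> punctured_ray m F \<Longrightarrow> s \<noteq> 0 \<Longrightarrow> x + s \<in> punctured_ray m F"
    by (auto simp: PF_def)
  have "F - m < x"
  proof (rule ccontr)
    assume "\<not> F - m < x"
    then have "F - x \<in> punctured_ray m F" "F - x \<noteq> 0"
      using gap assms by (auto simp: punctured_ray_def)
    from shift[OF this] show False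
      using assms by (simp add: punctured_ray_def)
  qed
  then show "x \<in> insert F {F - m<..<m}"
    using gap by (auto simp: punctured_ray_def)
next
  fix x assume "x \<in> insert F {F - m<..<m}"
  then show "x \<in> PF (punctured_ray m F)"
    using assms by (auto simp: PF_def punctured_ray_def)
qed

lemma sg_type_punctured_ray:
  assumes "0 < m" "m < F" "F < 2 * m"
  shows "int (sg_type (punctured_ray m F)) = 2 * m - F"
  using assms by (simp add: sg_type_def PF_punctured_ray)

lemma almost_symmetric_punctured_ray:
  assumes "0 < m" "m < F" "F < 2 * m"
  shows "almost_symmetric (punctured_ray m F)"
proof -
  have "2 * int (genus (punctured_ray m F)) =
      frobenius (punctured_ray m F) + int (sg_type (punctured_ray m F))"
    using assms
    by (simp add: genus_punctured_ray frobenius_punctured_ray sg_type_punctured_ray)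
  then have "2 * real (genus (punctured_ray m F)) =
      real_of_int (frobenius (punctured_ray m F)) + real (sg_type (punctured_ray m F))"
    by (metis of_int_add of_int_mult of_int_numeral of_int_of_nat_eq)
  then show ?thesis
    by (simp add: almost_symmetric_def)
qed

lemma maximal_reduced_type_punctured_ray:
  assumes "0 < m" "m < F"
  shows "maximal_reduced_type (punctured_ray m F)"
proof -
  have "rPF (punctured_ray m F) = insert F {F - m<..<m}"
    using assms
    by (auto simp: rPF_def frobenius_punctured_ray multiplicity_punctured_ray)
      (auto simp: punctured_ray_def)
  then show ?thesis
    using assms
    by (simp add: maximal_reduced_type_def reduced_type_def sg_type_def PF_punctured_ray)
qed

text \<open>The hypothesis \<open>m + 2 \<le> F\<close> is sharp: for \<open>F = m + 1\<close> the element \<open>2 * m + 1 = m + F\<close> is not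
  a sum of two nonzero elements, and it is a further minimal generator.\<close>

lemma msg_punctured_ray:
  assumes "0 < m" "m + 2 \<le> F" "F < 2 * m"
  shows "msg (punctured_ray m F) = {m..<2 * m} - {F}"
proof -
  let ?S = "punctured_ray m F"
  have nonzero: "?S - {0} = {m..} - {F}"
    using assms by (auto simp: punctured_ray_def)
  have S: "numerical_semigroup ?S"
    using assms by (intro numerical_semigroup_punctured_ray) auto
  then have "nat_submonoid ?S"
    by (simp add: numerical_semigroup_def)
  then have "msg ?S = {x \<in> ?S - {0}. \<forall>y\<in>?S - {0}. \<forall>z\<in>?S - {0}. x \<noteq> y + z}"
    using minimal_generators_msg[OF S] minimal_generators_iff by blast
  also have "\<dots> = {m..<2 * m} - {F}"
    unfolding nonzero
  proof (rule set_eqI, rule iffI)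
    fix x
    assume x: "x \<in> {x \<in> {m..} - {F}. \<forall>y\<in>{m..} - {F}. \<forall>z\<in>{m..} - {F}. x \<noteq> y + z}"
    have "x < 2 * m"
    proof (rule ccontr)
      assume "\<not> x < 2 * m"
      (* Subtracting m leaves the semigroup only for x = m + F, and then m + 1 takes the place of m. *)
      then have "\<exists>y\<in>{m..} - {F}. x - y \<in> {m..} - {F}"
        using assms by (cases "x = m + F") (auto intro: bexI[of _ m] bexI[of _ "m + 1"])
      then show False
        using x by force
    qed
    then show "x \<in> {m..<2 * m} - {F}"
      using x by auto
  qed auto
  finally show ?thesis .
qed

lemma embedding_dim_punctured_ray:
  assumes "0 < m" "m + 2 \<le> F" "F < 2 * m"
  shows "int (embedding_dim (punctured_ray m F)) = m - 1"
  using assms by (simp add: embedding_dim_def msg_punctured_ray card_Diff_singleton)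

theorem corollary3:
  fixes t e :: int
  assumes "2 \<le> t" and "t \<le> e - 1"
  shows "\<exists>S. numerical_semigroup S \<and> almost_symmetric S \<and> maximal_reduced_type S \<and>
    int (sg_type S) = t \<and> int (embedding_dim S) = e"
proof -
  define m F where "m = e + 1" and "F = 2 * (e + 1) - t"
  have bounds: "0 < m" "m \<le> F" "m < F" "m + 2 \<le> F" "F < 2 * m"
    using assms by (auto simp: m_def F_def)
  have "int (sg_type (punctured_ray m F)) = t"
    using sg_type_punctured_ray[of m F] bounds by (simp add: m_def F_def)
  moreover have "int (embedding_dim (punctured_ray m F)) = e"
    using embedding_dim_punctured_ray[of m F] bounds by (simp add: m_def)
  ultimately show ?thesis
    using bounds numerical_semigroup_punctured_ray almost_symmetric_punctured_ray
      maximal_reduced_type_punctured_ray by blast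
qed

end
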